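(* Let $n,d\in\mathbb{N}$ with $n>d$. There exists a regular $*$-irreducible $(n-d)$-domino tiling of the box $[0,2]^n$ if and only if $n\in\{d+1,d+2,\dots,2^d-1\}$.
   Context: For integers $n>d\geq 1$, an $(n-d)$-domino is a box $I_1\times\cdots\times I_n\subset[0,2]^n$ such that for some $N\subset[n]$ with $|N|=d$ we have $I_j\in\{[0,1],[1,2]\}$ for $j\in N$ and $I_i=[0,2]$ for $i\in[n]\setminus N$. Such a domino is identified with the word $u\in\{0,1,*\}^n$ where $u_j=0$ if $I_j=[0,1]$, $u_j=1$ if $I_j=[1,2]$, and $u_j=*$ if $I_j=[0,2]$. A family of $(n-d)$-dominoes is a tiling of $[0,2]^n$ if the interiors of any two distinct members are disjoint and their union is $[0,2]^n$ (such a tiling has $2^d$ members); we regard it as a set $D\subset\{0,1,*\}^n$ of words. A tiling $D$ is regular if there is a partition $[n]=N_1\,\dot\cup\cdots\dot\cup\,N_d\,\dot\cup\, N^*$ ($N^*$ possibly empty) such that: ($\alpha$) for each $i\in[d]$, $N_i$ is nonempty and the set $\{u|_{N_i}\colon u\in D\}$ of restrictions of the words of $D$ to the positions in $N_i$ (read in increasing order) is exactly the set of all words of length $|N_i|$ over $\{0,1,*\}$ having exactly one entry different from $*$ (i.e. $\{\delta*\cdots*,\ *\delta*\cdots*,\dots,*\cdots*\delta\colon \delta\in\{0,1\}\}$); ($\beta$) $u_j=*$ for every $u\in D$ and every $j\in N^*$. A tiling $D$ is $*$-irreducible if there is no $j\in[n]$ with $u_j=*$ for all $u\in D$. *)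

theory Defs
  imports "HOL-Analysis.Analysis"
begin

text \<open>
  Coordinates are numbered \<open>0, \<dots>, n - 1\<close>, so the index set \<open>[n]\<close> is \<open>{..<n}\<close> and
  \<open>\<real>\<^sup>n\<close> is the space \<open>powertop_real {..<n}\<close>, whose points are the functions extensional
  on \<open>{..<n}\<close>.
\<close>

datatype letter = Zero | One | Star

type_synonym word = "letter list"

primrec side :: "letter \<Rightarrow> real set" where
  "side Zero = {0..1}"
| "side One = {1..2}"
| "side Star = {0..2}"

definition word_box :: "word \<Rightarrow> (nat \<Rightarrow> real) set" where
  "word_box u = (\<Pi>\<^sub>E i\<in>{..<length u}. side (u ! i))"

definition is_domino :: "nat \<Rightarrow> nat \<Rightarrow> (nat \<Rightarrow> real) set \<Rightarrow> bool" where
  "is_domino n d B \<longleftrightarrow>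
     (\<exists>N I. N \<subseteq> {..<n} \<and> card N = d \<and>
            (\<forall>j\<in>N. I j \<in> {{0..1}, {1..2}}) \<and> (\<forall>i\<in>{..<n} - N. I i = {0..2}) \<and>
            B = (\<Pi>\<^sub>E i\<in>{..<n}. I i))"

definition domino_tiling :: "nat \<Rightarrow> nat \<Rightarrow> word set \<Rightarrow> bool" where
  "domino_tiling n d D \<longleftrightarrow>
     (\<forall>u\<in>D. length u = n \<and> is_domino n d (word_box u)) \<and>
     (\<forall>u\<in>D. \<forall>v\<in>D. u \<noteq> v \<longrightarrow>
        (powertop_real {..<n} interior_of word_box u) \<inter>
        (powertop_real {..<n} interior_of word_box v) = {}) \<and>
     (\<Union>u\<in>D. word_box u) = (\<Pi>\<^sub>E i\<in>{..<n}. {0..2})"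

definition regular_tiling :: "nat \<Rightarrow> nat \<Rightarrow> word set \<Rightarrow> bool" where
  "regular_tiling n d D \<longleftrightarrow>
     (\<exists>N Nstar.
        disjoint_family_on N {1..d} \<and>
        (\<Union>i\<in>{1..d}. N i) \<inter> Nstar = {} \<and>
        (\<Union>i\<in>{1..d}. N i) \<union> Nstar = {..<n} \<and>
        (\<forall>i\<in>{1..d}. N i \<noteq> {} \<and>
           (\<lambda>u. nths u (N i)) ` D =
             {w. length w = card (N i) \<and> (\<exists>!j. j < length w \<and> w ! j \<noteq> Star)}) \<and>
        (\<forall>u\<in>D. \<forall>j\<in>Nstar. u ! j = Star))"

definition star_irreducible :: "nat \<Rightarrow> word set \<Rightarrow> bool" where
  "star_irreducible n D \<longleftrightarrow> \<not> (\<exists>j<n. \<forall>u\<in>D. u ! j = Star)"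

text \<open>
  By the following two facts, \<open>word_box\<close> is a bijection from the words of length \<open>n\<close> with
  exactly \<open>d\<close> entries different from \<open>Star\<close> onto the \<open>(n - d)\<close>-dominoes in \<open>[0,2]\<^sup>n\<close>.
\<close>

lemma side_inj: "side a = side b \<longleftrightarrow> a = b"
  by (cases a; cases b) (auto simp: Icc_eq_Icc)

lemma side_nonempty: "side a \<noteq> {}"
  by (cases a) auto

lemma word_box_inj: "inj_on word_box {u. length u = n}"
proof (rule inj_onI)
  fix u v :: word
  assume "u \<in> {u. length u = n}" "v \<in> {u. length u = n}" and eq: "word_box u = word_box v"
  then have len: "length u = n" "length v = n" by auto
  have "\<forall>i\<in>{..<n}. side (u ! i) = side (v ! i)"
    using eq len by (simp add: word_box_def PiE_eq_iff side_nonempty)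
  then show "u = v"
    using len by (auto simp: side_inj intro: nth_equalityI)
qed

lemma is_domino_iff_word:
  "is_domino n d B \<longleftrightarrow>
     (\<exists>u. length u = n \<and> card {j. j < n \<and> u ! j \<noteq> Star} = d \<and> B = word_box u)"
proof
  assume "is_domino n d B"
  then obtain N I where N: "N \<subseteq> {..<n}" "card N = d"
    and I: "\<forall>j\<in>N. I j \<in> {{0..1}, {1..2}}" "\<forall>i\<in>{..<n} - N. I i = {0..2}"
    and B: "B = (\<Pi>\<^sub>E i\<in>{..<n}. I i)"
    unfolding is_domino_def by blast
  have "\<exists>a. I i = side a \<and> (a \<noteq> Star \<longleftrightarrow> i \<in> N)" if "i < n" for i
  proof (cases "i \<in> N")
    case True
    then consider "I i = side Zero" | "I i = side One" using I by auto
    then show ?thesis using True by cases blast+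
  next
    case False
    then have "I i = side Star" using I that by auto
    then show ?thesis using False by blast
  qed
  then obtain f where f: "\<And>i. i < n \<Longrightarrow> I i = side (f i) \<and> (f i \<noteq> Star \<longleftrightarrow> i \<in> N)"
    by metis
  let ?u = "map f [0..<n]"
  have "j < n \<and> ?u ! j \<noteq> Star \<longleftrightarrow> j \<in> N" for j
    using f[of j] N(1) by (cases "j < n") auto
  then have "{j. j < n \<and> ?u ! j \<noteq> Star} = N" by blast
  moreover have "B = word_box ?u"
    unfolding B word_box_def by (auto intro!: PiE_cong simp: f)
  ultimately show "\<exists>u. length u = n \<and> card {j. j < n \<and> u ! j \<noteq> Star} = d \<and> B = word_box u"
    using N by (intro exI[of _ ?u]) simp
next
  assume "\<exists>u. length u = n \<and> card {j. j < n \<and> u ! j \<noteq> Star} = d \<and> B = word_box u"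
  then obtain u where u: "length u = n" "card {j. j < n \<and> u ! j \<noteq> Star} = d" "B = word_box u"
    by blast
  have "side a \<in> {{0..1}, {1..2}}" if "a \<noteq> Star" for a
    using that by (cases a) auto
  then show "is_domino n d B"
    unfolding is_domino_def using u
    by (intro exI[of _ "{j. j < n \<and> u ! j \<noteq> Star}"] exI[of _ "\<lambda>i. side (u ! i)"])
       (auto simp: word_box_def)
qed

end

theory Submission
  imports Defs
begin

text \<open>
  A tiling of \<open>[0,2]\<^sup>n\<close> is a partition of the discrete cube into subcubes. Summing the characters
  of the discrete cube over this partition shows that the sign vectors (entries \<open>1, -1, 0\<close> for
  \<open>Zero, One, Star\<close>) of the \<open>n\<close> coordinates, indexed by the \<open>2\<^sup>d\<close> words of the tiling,
  are pairwise orthogonal and orthogonal to the constant vector. They are nonzero when the tiling is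
  \<open>*\<close>-irreducible, so \<open>n + 1 \<le> 2\<^sup>d\<close>.

  Conversely, two tilings \<open>D\<^sub>0\<close>, \<open>D\<^sub>1\<close> with parameter \<open>d\<close> give the tiling
  \<open>0D\<^sub>0 \<union> 1D\<^sub>1\<close> with parameter \<open>d + 1\<close>, where \<open>D\<^sub>0\<close> and \<open>D\<^sub>1\<close> either use
  disjoint sets of coordinates or are equal. Together these two options reach every dimension from
  \<open>d + 1\<close> to \<open>2\<^sup>d\<^sup>+\<^sup>1 - 1\<close>.
\<close>

section \<open>Tilings as partitions of the discrete cube\<close>

definition fixed :: "word \<Rightarrow> nat set" where
  "fixed u = {j. j < length u \<and> u ! j \<noteq> Star}"

text \<open>The bit \<open>True\<close> stands for the half \<open>{1..2}\<close> of a side. The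
  point \<open>x\<close> is a total function on the naturals, but only its values below
  \<open>length u\<close> count.\<close>

definition agrees :: "word \<Rightarrow> (nat \<Rightarrow> bool) \<Rightarrow> bool" where
  "agrees u x \<longleftrightarrow> (\<forall>j<length u. u ! j = Star \<or> (u ! j = One) = x j)"

text \<open>The centre of the unit cell that belongs to \<open>x\<close>. Since it avoids all cell
  boundaries, lying in a box and lying in its interior amount to the same.\<close>

definition cube_point :: "nat \<Rightarrow> (nat \<Rightarrow> bool) \<Rightarrow> nat \<Rightarrow> real" where
  "cube_point n x = (\<lambda>i\<in>{..<n}. if x i then 3/2 else 1/2)"

lemma fixed_append_Stars: "fixed (u @ replicate m Star) = fixed u"
proof (rule set_eqI)
  fix j show "j \<in> fixed (u @ replicate m Star) \<longleftrightarrow> j \<in> fixed u"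
    by (cases "j < length u") (auto simp: fixed_def nth_append)
qed

lemma cube_point_in_interior:
  assumes "length u = n" "agrees u x"
  shows "cube_point n x \<in> powertop_real {..<n} interior_of word_box u"
proof -
  \<comment> \<open>\<open>X\<close> is the whole line outside \<open>{..<n}\<close> because a basic
    open set may restrict only finitely many factors.\<close>
  define X where "X i = (if i < n then interior (side (u ! i)) else UNIV)" for i
  have "openin (powertop_real {..<n}) (\<Pi>\<^sub>E i\<in>{..<n}. X i)"
    by (rule product_topology_basis) (auto simp: X_def intro: finite_subset[of _ "{..<n}"])
  moreover have "(\<Pi>\<^sub>E i\<in>{..<n}. X i) \<subseteq> word_box u"
    unfolding word_box_def assms(1) using interior_subset by (intro PiE_mono) (auto simp: X_def)
  moreover have "cube_point n x \<in> (\<Pi>\<^sub>E i\<in>{..<n}. X i)"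
  proof (rule PiE_I)
    fix i assume i: "i \<in> {..<n}"
    then have "u ! i = Star \<or> (u ! i = One) = x i" using assms by (auto simp: agrees_def)
    with i show "cube_point n x i \<in> X i"
      by (cases "u ! i") (auto simp: X_def cube_point_def)
  qed (simp add: cube_point_def)
  ultimately show ?thesis unfolding interior_of_def by blast
qed

lemma cube_point_in_word_box:
  assumes "length u = n"
  shows "cube_point n x \<in> word_box u \<longleftrightarrow> agrees u x"
proof
  assume "cube_point n x \<in> word_box u"
  then have "cube_point n x j \<in> side (u ! j)" if "j < n" for j
    using that assms by (auto simp: word_box_def)
  then have "u ! j = Star \<or> (u ! j = One) = x j" if "j < n" for j
    using that by (cases "u ! j") (fastforce simp: cube_point_def split: if_splits)+
  then show "agrees u x" using assms by (simp add: agrees_def)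
next
  assume "agrees u x"
  then show "cube_point n x \<in> word_box u"
    using cube_point_in_interior[OF assms] interior_of_subset by (metis subsetD)
qed

lemma interiors_disjointI:
  assumes "length u = n" "length v = n" "\<not> (\<exists>x. agrees u x \<and> agrees v x)"
  shows "powertop_real {..<n} interior_of word_box u \<inter>
         powertop_real {..<n} interior_of word_box v = {}"
proof -
  have "\<exists>j<n. u ! j \<noteq> Star \<and> v ! j \<noteq> Star \<and> u ! j \<noteq> v ! j"
  proof (rule ccontr)
    assume "\<not> ?thesis"
    then have *: "u ! j = Star \<or> v ! j = Star \<or> u ! j = v ! j" if "j < n" for j
      using that by blast
    \<comment> \<open>Without a conflict this point respects both words; coordinates where neither
      word has \<open>One\<close> receive \<open>False\<close>.\<close>
    let ?x = "\<lambda>j. u ! j = One \<or> v ! j = One"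
    have "agrees u ?x" "agrees v ?x"
      unfolding agrees_def assms(1,2) using * letter.distinct by metis+
    with assms(3) show False by blast
  qed
  then obtain j where j: "j < n" "u ! j \<noteq> Star" "v ! j \<noteq> Star" "u ! j \<noteq> v ! j" by blast
  \<comment> \<open>Coordinate projections are open maps, so the interior of a box projects to an
    open subset of its side.\<close>
  have proj: "y j \<in> interior (side (w ! j))"
    if "length w = n" "y \<in> powertop_real {..<n} interior_of word_box w" for w y
  proof -
    let ?I = "powertop_real {..<n} interior_of word_box w"
    have "open ((\<lambda>f. f j) ` ?I)"
      using open_map_product_projection[of j "{..<n}" "\<lambda>_. euclideanreal"] j(1)
      by (simp add: open_map_def)
    moreover have "(\<lambda>f. f j) ` ?I \<subseteq> side (w ! j)"
      using interior_of_subset[of "powertop_real {..<n}" "word_box w"] j(1) that(1)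
      by (auto simp: word_box_def)
    ultimately show ?thesis using that(2) by (meson imageI interiorI)
  qed
  have "interior (side (u ! j)) \<inter> interior (side (v ! j)) = {}"
    using j(2-4) by (cases "u ! j"; cases "v ! j") auto
  then show ?thesis using proj[OF assms(1)] proj[OF assms(2)] by blast
qed

lemma is_domino_word_box:
  assumes "length u = n"
  shows "is_domino n d (word_box u) \<longleftrightarrow> card (fixed u) = d"
proof -
  have "v = u" if "length v = n" "word_box u = word_box v" for v
    using that assms by (metis (mono_tags) word_box_inj inj_onD mem_Collect_eq)
  then show ?thesis
    unfolding is_domino_iff_word fixed_def using assms by metis
qed

text \<open>Every domino is a union of unit cells, so it is determined by the cell centres it
  contains. A centre lies in some domino because the dominoes cover, and in only one because it is
  an interior point.\<close>

lemma domino_tiling_iff: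
  "domino_tiling n d D \<longleftrightarrow>
     (\<forall>u\<in>D. length u = n \<and> card (fixed u) = d) \<and> (\<forall>x. \<exists>!u. u \<in> D \<and> agrees u x)"
proof
  assume tiling: "domino_tiling n d D"
  then have len: "length u = n" if "u \<in> D" for u using that by (simp add: domino_tiling_def)
  have "\<exists>!u. u \<in> D \<and> agrees u x" for x
  proof (rule ex_ex1I)
    have "cube_point n x \<in> (\<Pi>\<^sub>E i\<in>{..<n}. {0..2})" by (auto simp: cube_point_def)
    then obtain u where "u \<in> D" "cube_point n x \<in> word_box u"
      using tiling unfolding domino_tiling_def by blast
    then show "\<exists>u. u \<in> D \<and> agrees u x" using len cube_point_in_word_box by blast
  next
    fix u v assume "u \<in> D \<and> agrees u x" "v \<in> D \<and> agrees v x"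
    then show "u = v"
      using tiling cube_point_in_interior len unfolding domino_tiling_def by blast
  qed
  then show "(\<forall>u\<in>D. length u = n \<and> card (fixed u) = d) \<and> (\<forall>x. \<exists>!u. u \<in> D \<and> agrees u x)"
    using tiling is_domino_word_box by (auto simp: domino_tiling_def)
next
  assume R: "(\<forall>u\<in>D. length u = n \<and> card (fixed u) = d) \<and> (\<forall>x. \<exists>!u. u \<in> D \<and> agrees u x)"
  have "(\<Union>u\<in>D. word_box u) = (\<Pi>\<^sub>E i\<in>{..<n}. {0..2})"
  proof (intro equalityI subsetI)
    fix y assume "y \<in> (\<Union>u\<in>D. word_box u)"
    then obtain u where "u \<in> D" "y \<in> word_box u" by blast
    moreover have "side a \<subseteq> {0..2}" for a by (cases a) auto
    ultimately show "y \<in> (\<Pi>\<^sub>E i\<in>{..<n}. {0..2})"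
      using R PiE_mono[of "{..<n}" "\<lambda>i. side (u ! i)" "\<lambda>_. {0..2}"] by (auto simp: word_box_def)
  next
    fix y :: "nat \<Rightarrow> real" assume y: "y \<in> (\<Pi>\<^sub>E i\<in>{..<n}. {0..2})"
    \<comment> \<open>Rounding \<open>y\<close> picks a unit cell containing it. Ties at 1 go to the
      lower half, which is harmless since the sides are closed.\<close>
    from R obtain u where u: "u \<in> D" "length u = n" "agrees u (\<lambda>i. y i > 1)" by metis
    have "y i \<in> side (u ! i)" if "i < n" for i
    proof -
      have "0 \<le> y i" "y i \<le> 2" using y that by (auto simp: PiE_iff)
      moreover have "u ! i = Star \<or> (u ! i = One) = (y i > 1)"
        using u that by (auto simp: agrees_def)
      ultimately show ?thesis by (cases "u ! i") auto
    qed
    then have "y \<in> word_box u" using y u(2) by (auto simp: word_box_def PiE_iff)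
    with u(1) show "y \<in> (\<Union>u\<in>D. word_box u)" by blast
  qed
  moreover have "powertop_real {..<n} interior_of word_box u \<inter>
      powertop_real {..<n} interior_of word_box v = {}" if "u \<in> D" "v \<in> D" "u \<noteq> v" for u v
    using that R by (intro interiors_disjointI) metis+
  moreover have "length u = n \<and> is_domino n d (word_box u)" if "u \<in> D" for u
    using R that is_domino_word_box by simp
  ultimately show "domino_tiling n d D"
    unfolding domino_tiling_def by simp
qed

section \<open>The upper bound\<close>

text \<open>Bessel's inequality for the indicator of each point \<open>u\<close> bounds the sum of
  \<open>f j u * f j u / Q j\<close> over \<open>J\<close> by 1. Summing over all \<open>u\<close>
  in \<open>A\<close> turns each \<open>j\<close> into \<open>Q j / Q j = 1\<close>.\<close>

lemma card_orthogonal_le: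
  fixes f :: "'j \<Rightarrow> 'a \<Rightarrow> real"
  assumes "finite A" "finite J"
    and orth: "\<And>i j. i \<in> J \<Longrightarrow> j \<in> J \<Longrightarrow> i \<noteq> j \<Longrightarrow> (\<Sum>v\<in>A. f i v * f j v) = 0"
    and nz: "\<And>j. j \<in> J \<Longrightarrow> \<exists>v\<in>A. f j v \<noteq> 0"
  shows "card J \<le> card A"
proof -
  define Q where "Q j = (\<Sum>v\<in>A. f j v * f j v)" for j
  have Q: "Q j \<noteq> 0" if "j \<in> J" for j
    using nz[OF that] \<open>finite A\<close> by (auto simp: Q_def sum_nonneg_eq_0_iff)
  have bessel: "(\<Sum>j\<in>J. f j u * f j u / Q j) \<le> 1" if "u \<in> A" for u
  proof -
    \<comment> \<open>\<open>P\<close> is the orthogonal projection of the indicator of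
      \<open>u\<close> onto the span of the \<open>f j\<close>, with Fourier coefficients
      \<open>c j\<close>. Its squared norm is \<open>P u\<close>, so the squared distance from the
      indicator to \<open>P\<close> is \<open>1 - P u\<close>.\<close>
    define c where "c j = f j u / Q j" for j
    define P where "P v = (\<Sum>j\<in>J. c j * f j v)" for v
    have inner: "(\<Sum>v\<in>A. f i v * P v) = f i u" if "i \<in> J" for i
    proof -
      have "(\<Sum>v\<in>A. f i v * P v) = (\<Sum>j\<in>J. c j * (\<Sum>v\<in>A. f i v * f j v))"
        unfolding P_def sum_distrib_left by (subst sum.swap) (simp add: mult_ac)
      also have "\<dots> = (\<Sum>j\<in>J. if i = j then c i * Q i else 0)"
        using that orth by (intro sum.cong) (auto simp: Q_def)
      also have "\<dots> = f i u" using that \<open>finite J\<close> Q by (simp add: c_def)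
      finally show ?thesis .
    qed
    have "(\<Sum>v\<in>A. P v * P v) = (\<Sum>i\<in>J. c i * (\<Sum>v\<in>A. f i v * P v))"
      unfolding P_def[of v for v] sum_distrib_left sum_distrib_right
      by (subst sum.swap) (simp add: mult_ac)
    also have "\<dots> = P u" using inner by (simp add: P_def)
    finally have PP: "(\<Sum>v\<in>A. P v * P v) = P u" .
    have "0 \<le> (\<Sum>v\<in>A. ((if v = u then 1 else 0) - P v)\<^sup>2)" by (intro sum_nonneg) simp
    also have "\<dots> = (\<Sum>v\<in>A. (if v = u then 1 - 2 * P u else 0) + P v * P v)"
      by (intro sum.cong) (auto simp: power2_eq_square algebra_simps)
    also have "\<dots> = 1 - P u"
      using that \<open>finite A\<close> by (simp add: sum.distrib PP)
    finally show ?thesis by (simp add: P_def c_def mult_ac)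
  qed
  have "real (card J) = (\<Sum>j\<in>J. Q j / Q j)" using Q by simp
  also have "\<dots> = (\<Sum>u\<in>A. \<Sum>j\<in>J. f j u * f j u / Q j)"
    by (subst sum.swap) (simp add: Q_def flip: sum_divide_distrib)
  also have "\<dots> \<le> (\<Sum>u\<in>A. 1)" by (intro sum_mono bessel)
  finally show ?thesis by simp
qed

text \<open>The mean of the signs of the bits that the letter admits, \<open>False\<close> counting
  1 and \<open>True\<close> counting -1.\<close>

primrec letter_sign :: "letter \<Rightarrow> real" where
  "letter_sign Zero = 1"
| "letter_sign One = -1"
| "letter_sign Star = 0"

text \<open>The sum factors over the coordinates. Each one contributes the number of bits its letter
  admits, times the mean sign if it lies in \<open>T\<close>.\<close>

lemma sum_character_subcube:
  assumes "length u = n" "T \<subseteq> {..<n}"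
  shows "(\<Sum>x\<in>{..<n} \<rightarrow>\<^sub>E UNIV. if agrees u x then \<Prod>j\<in>T. if x j then -1 else 1 else 0) =
         2 ^ (n - card (fixed u)) * (\<Prod>j\<in>T. letter_sign (u ! j))"
proof -
  \<comment> \<open>The factor of coordinate \<open>j\<close> at bit \<open>b\<close>; it vanishes
    when the letter forbids \<open>b\<close>, which encodes \<open>agrees\<close> inside the
    product.\<close>
  define g :: "nat \<Rightarrow> bool \<Rightarrow> real" where
    "g j b = (if u ! j = Star \<or> (u ! j = One) = b then if j \<in> T then if b then -1 else 1 else 1 else 0)"
    for j b
  have "(if agrees u x then \<Prod>j\<in>T. if x j then -1 else 1 else 0) = (\<Prod>j<n. g j (x j))" for x
  proof (cases "agrees u x")
    case True
    have "(\<Prod>j\<in>T. if x j then -1 else 1 :: real) = (\<Prod>j<n. if j \<in> T then if x j then -1 else 1 else 1)"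
      using assms(2) by (subst prod.inter_restrict[symmetric]) (auto simp: Int_absorb1)
    also have "\<dots> = (\<Prod>j<n. g j (x j))"
      using True assms(1) by (intro prod.cong) (auto simp: g_def agrees_def)
    finally show ?thesis using True by simp
  next
    case False
    then obtain j where j: "j < n" "\<not> (u ! j = Star \<or> (u ! j = One) = x j)"
      using assms(1) by (auto simp: agrees_def)
    then have "g j (x j) = 0" unfolding g_def by (subst if_not_P) auto
    with j(1) have "(\<Prod>j<n. g j (x j)) = 0" by (intro prod_zero) auto
    then show ?thesis using False by simp
  qed
  then have "(\<Sum>x\<in>{..<n} \<rightarrow>\<^sub>E UNIV. if agrees u x then \<Prod>j\<in>T. if x j then -1 else 1 else 0) =
      (\<Prod>j<n. \<Sum>b\<in>UNIV. g j b)"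
    by (simp add: prod_sum_PiE)
  also have "\<dots> = (\<Prod>j<n. (if u ! j = Star then 2 else 1) * (if j \<in> T then letter_sign (u ! j) else 1))"
  proof (rule prod.cong)
    fix j
    show "(\<Sum>b\<in>UNIV. g j b) =
        (if u ! j = Star then 2 else 1) * (if j \<in> T then letter_sign (u ! j) else 1)"
      by (cases "u ! j") (auto simp: g_def UNIV_bool)
  qed simp
  also have "\<dots> = (\<Prod>j<n. if u ! j = Star then 2 else 1) * (\<Prod>j\<in>T. letter_sign (u ! j))"
    using assms(2) by (simp add: prod.distrib prod.inter_restrict[symmetric] Int_absorb1)
  also have "(\<Prod>j<n. if u ! j = Star then 2 else 1 :: real) = 2 ^ card ({..<n} - fixed u)"
    by (simp add: prod.If_cases fixed_def assms(1) Int_def set_diff_eq conj_commute)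
       (metis (no_types, lifting))
  also have "card ({..<n} - fixed u) = n - card (fixed u)"
    by (subst card_Diff_subset) (auto simp: fixed_def assms(1))
  finally show ?thesis .
qed

text \<open>The character of \<open>T\<close> is summed over the cube in two ways: tile by tile, and
  as a whole, where it cancels unless \<open>T\<close> is empty.\<close>

lemma sum_letter_sign_tiling:
  assumes "domino_tiling n d D" "d \<le> n" "T \<subseteq> {..<n}"
  shows "finite D" and "(\<Sum>u\<in>D. \<Prod>j\<in>T. letter_sign (u ! j)) = (if T = {} then 2 ^ d else 0)"
proof -
  have len: "length u = n" "card (fixed u) = d" if "u \<in> D" for u
    using assms(1) that by (auto simp: domino_tiling_iff)
  have part: "\<exists>!u. u \<in> D \<and> agrees u x" for x
    using assms(1) by (auto simp: domino_tiling_iff)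
  have letters: "(UNIV :: letter set) = {Zero, One, Star}"
    using letter.exhaust by auto
  have "finite {u :: word. set u \<subseteq> UNIV \<and> length u = n}"
    by (rule finite_lists_length_eq) (simp add: letters)
  then show fin: "finite D" by (rule finite_subset[rotated]) (auto simp: len)
  define character :: "(nat \<Rightarrow> bool) \<Rightarrow> real" where "character x = (\<Prod>j\<in>T. if x j then -1 else 1)" for x
  let ?C = "{..<n} \<rightarrow>\<^sub>E (UNIV :: bool set)"
  have "2 ^ (n - d) * (\<Sum>u\<in>D. \<Prod>j\<in>T. letter_sign (u ! j)) =
      (\<Sum>u\<in>D. \<Sum>x\<in>?C. if agrees u x then character x else 0)"
    unfolding sum_distrib_left character_def
    by (intro sum.cong refl) (simp add: sum_character_subcube[OF _ assms(3)] len)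
  also have "\<dots> = (\<Sum>x\<in>?C. \<Sum>u\<in>D. if agrees u x then character x else 0)" by (rule sum.swap)
  also have "\<dots> = (\<Sum>x\<in>?C. character x)"
  proof (intro sum.cong refl)
    fix x
    obtain u where u: "u \<in> D" "\<And>v. v \<in> D \<Longrightarrow> agrees v x \<longleftrightarrow> v = u" using part[of x] by metis
    then have "(\<Sum>v\<in>D. if agrees v x then character x else 0) = (\<Sum>v\<in>D. if v = u then character x else 0)"
      by (intro sum.cong) auto
    also have "\<dots> = character x" using fin u(1) by simp
    finally show "(\<Sum>v\<in>D. if agrees v x then character x else 0) = character x" .
  qed
  \<comment> \<open>The full cube is the subcube of the all-\<open>Star\<close> word, so the same
    formula evaluates the total.\<close>
  also have "\<dots> = 2 ^ n * (\<Prod>j\<in>T. letter_sign (replicate n Star ! j))"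
    using sum_character_subcube[of "replicate n Star" n T] assms(3) fixed_append_Stars[of "[]" n]
    by (simp add: agrees_def character_def fixed_def[of "[]"])
  also have "(\<Prod>j\<in>T. letter_sign (replicate n Star ! j)) = (if T = {} then 1 else 0)"
  proof (cases "T = {}")
    case False
    then obtain j where "j \<in> T" "j < n" using assms(3) by blast
    then have "\<exists>j\<in>T. letter_sign (replicate n Star ! j) = 0" by (intro bexI[of _ j]) simp_all
    then show ?thesis using False finite_subset[OF assms(3)] by (simp add: prod_zero)
  qed simp
  also have "2 ^ n * (if T = {} then 1 else 0 :: real) = 2 ^ (n - d) * (if T = {} then 2 ^ d else 0)"
    using assms(2) by (simp flip: power_add)
  finally show "(\<Sum>u\<in>D. \<Prod>j\<in>T. letter_sign (u ! j)) = (if T = {} then 2 ^ d else 0)"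
    by simp
qed

lemma star_irreducible_dimension_bound:
  assumes "domino_tiling n d D" "d \<le> n" "star_irreducible n D"
  shows "n + 1 \<le> 2 ^ d"
proof -
  note fin = sum_letter_sign_tiling(1)[OF assms(1,2) empty_subsetI]
  note sums = sum_letter_sign_tiling(2)[OF assms(1,2)]
  \<comment> \<open>The empty set yields the constant vector and each singleton a coordinate vector.
    Distinct members are disjoint with nonempty union, so the product of their vectors is a
    character sum that vanishes.\<close>
  define J where "J = insert {} ((\<lambda>j. {j}) ` {..<n})"
  have J: "T \<subseteq> {..<n}" "finite T" if "T \<in> J" for T using that by (auto simp: J_def)
  have card_D: "card D = 2 ^ d"
    using sums[of "{}"] by simp
  have "card J \<le> card D"
  proof (rule card_orthogonal_le[where f = "\<lambda>T u. \<Prod>j\<in>T. letter_sign (u ! j)"])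
    fix S T assume ST: "S \<in> J" "T \<in> J" "S \<noteq> T"
    then have "S \<inter> T = {}" "S \<union> T \<noteq> {}" by (auto simp: J_def)
    then show "(\<Sum>u\<in>D. (\<Prod>j\<in>S. letter_sign (u ! j)) * (\<Prod>j\<in>T. letter_sign (u ! j))) = 0"
      using sums[of "S \<union> T"] J[OF ST(1)] J[OF ST(2)] by (simp add: prod.union_disjoint)
  next
    fix T assume "T \<in> J"
    moreover have "\<exists>u\<in>D. letter_sign (u ! j) \<noteq> 0" if "j < n" for j
    proof -
      obtain u where "u \<in> D" "u ! j \<noteq> Star"
        using assms(3) \<open>j < n\<close> unfolding star_irreducible_def by blast
      then show ?thesis by (intro bexI[of _ u]) (cases "u ! j"; simp)
    qed
    moreover have "D \<noteq> {}" using card_D by auto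
    ultimately show "\<exists>u\<in>D. (\<Prod>j\<in>T. letter_sign (u ! j)) \<noteq> 0" by (auto simp: J_def)
  qed (simp_all add: fin J_def)
  moreover have "card J = n + 1"
    unfolding J_def by (subst card_insert_disjoint) (auto simp: card_image inj_on_def)
  ultimately show ?thesis using card_D by simp
qed

section \<open>Construction of regular tilings\<close>

text \<open>The map \<open>p\<close> encodes the partition by \<open>N\<^sub>i = {j. j < n \<and> p j = i}\<close>.\<close>

definition rainbow_tiling :: "nat \<Rightarrow> nat \<Rightarrow> (nat \<Rightarrow> nat) \<Rightarrow> word set \<Rightarrow> bool" where
  "rainbow_tiling n d p D \<longleftrightarrow>
     (\<forall>u\<in>D. length u = n \<and> bij_betw p (fixed u) {1..d}) \<and>
     (\<forall>x. \<exists>!u. u \<in> D \<and> agrees u x)"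

text \<open>Stronger than star-irreducibility: both signs at each coordinate are what makes the
  restrictions to a block exhaust all required words.\<close>

definition all_letters_occur :: "nat \<Rightarrow> word set \<Rightarrow> bool" where
  "all_letters_occur n D \<longleftrightarrow> (\<forall>j<n. \<forall>a. a \<noteq> Star \<longrightarrow> (\<exists>u\<in>D. u ! j = a))"

section \<open>Padding words with stars and prefixing a letter\<close>

lemma fixed_Cons: "fixed (a # u) = (if a = Star then {} else {0}) \<union> Suc ` fixed u"
proof (rule set_eqI)
  fix j show "j \<in> fixed (a # u) \<longleftrightarrow> j \<in> (if a = Star then {} else {0}) \<union> Suc ` fixed u"
    by (cases j) (auto simp: fixed_def)
qed

lemma fixed_Stars_append: "fixed (replicate m Star @ u) = (+) m ` fixed u"
proof (rule set_eqI)
  fix j show "j \<in> fixed (replicate m Star @ u) \<longleftrightarrow> j \<in> (+) m ` fixed u"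
    by (cases "j < m") (auto simp: fixed_def nth_append image_iff intro!: exI[of _ "j - m"])
qed

lemma agrees_Cons: "agrees (a # u) x \<longleftrightarrow> (a = Star \<or> (a = One) = x 0) \<and> agrees u (\<lambda>j. x (Suc j))"
  by (simp add: agrees_def All_less_Suc2)

lemma agrees_append_Stars: "agrees (u @ replicate m Star) x \<longleftrightarrow> agrees u x"
  by (auto simp: agrees_def nth_append)

lemma agrees_Stars_append: "agrees (replicate m Star @ u) x \<longleftrightarrow> agrees u (\<lambda>j. x (m + j))"
proof
  assume L: "agrees (replicate m Star @ u) x"
  show "agrees u (\<lambda>j. x (m + j))"
    unfolding agrees_def
  proof (intro allI impI)
    fix j assume "j < length u"
    then show "u ! j = Star \<or> (u ! j = One) = x (m + j)"
      using L[unfolded agrees_def, rule_format, of "m + j"] by (simp add: nth_append)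
  qed
next
  assume R: "agrees u (\<lambda>j. x (m + j))"
  show "agrees (replicate m Star @ u) x"
    unfolding agrees_def
  proof (intro allI impI)
    fix j assume "j < length (replicate m Star @ u)"
    then show "(replicate m Star @ u) ! j = Star \<or> ((replicate m Star @ u) ! j = One) = x j"
      using R[unfolded agrees_def, rule_format, of "j - m"] by (cases "j < m") (auto simp: nth_append)
  qed
qed

lemma bij_betw_image_shift:
  assumes "bij_betw p A B" "inj_on g A" "\<And>a. a \<in> A \<Longrightarrow> q (g a) = p a"
  shows "bij_betw q (g ` A) B"
proof -
  have "bij_betw (q \<circ> g) A B" using assms by (subst bij_betw_cong[of A _ p]) auto
  then show ?thesis
    using bij_betw_comp_iff[of g A "g ` A" q B] assms(2) by (simp add: inj_on_imp_bij_betw)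
qed

text \<open>Padding adds no fixed positions, so \<open>q\<close> is constrained only on the original
  coordinates. This freedom lets two tilings padded on opposite sides share one partition
  map.\<close>

lemma rainbow_tiling_append_Stars:
  assumes "rainbow_tiling n d p D" "\<And>j. j < n \<Longrightarrow> q j = p j"
  shows "rainbow_tiling (n + m) d q ((\<lambda>u. u @ replicate m Star) ` D)"
  unfolding rainbow_tiling_def
proof (intro conjI ballI allI)
  fix w assume "w \<in> (\<lambda>u. u @ replicate m Star) ` D"
  then obtain u where u: "u \<in> D" "w = u @ replicate m Star" by blast
  then show "length w = n + m" using assms(1) by (simp add: rainbow_tiling_def)
  have "bij_betw p (fixed u) {1..d}" "length u = n" using assms(1) u by (auto simp: rainbow_tiling_def)
  then show "bij_betw q (fixed w) {1..d}"
    unfolding u(2) fixed_append_Stars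
    using assms(2) by (subst bij_betw_cong[of _ _ p]) (auto simp: fixed_def)
next
  fix x
  have "\<exists>!u. u \<in> D \<and> agrees u x" using assms(1) by (auto simp: rainbow_tiling_def)
  then show "\<exists>!w. w \<in> (\<lambda>u. u @ replicate m Star) ` D \<and> agrees w x"
    by (auto simp: agrees_append_Stars)
qed

lemma rainbow_tiling_Stars_append:
  assumes "rainbow_tiling n d p D" "\<And>j. j < n \<Longrightarrow> q (m + j) = p j"
  shows "rainbow_tiling (m + n) d q ((\<lambda>u. replicate m Star @ u) ` D)"
  unfolding rainbow_tiling_def
proof (intro conjI ballI allI)
  fix w assume "w \<in> (\<lambda>u. replicate m Star @ u) ` D"
  then obtain u where u: "u \<in> D" "w = replicate m Star @ u" by blast
  then show "length w = m + n" using assms(1) by (simp add: rainbow_tiling_def)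
  have "bij_betw p (fixed u) {1..d}" "length u = n" using assms(1) u by (auto simp: rainbow_tiling_def)
  then show "bij_betw q (fixed w) {1..d}"
    unfolding u(2) fixed_Stars_append
    using assms(2) by (intro bij_betw_image_shift) (auto simp: fixed_def)
next
  fix x
  have "\<exists>!u. u \<in> D \<and> agrees u (\<lambda>j. x (m + j))" using assms(1) by (auto simp: rainbow_tiling_def)
  then show "\<exists>!w. w \<in> (\<lambda>u. replicate m Star @ u) ` D \<and> agrees w x"
    by (auto simp: agrees_Stars_append)
qed

text \<open>The new coordinate 0 is fixed in every word and forms a block of its own, labelled
  \<open>Suc d\<close>. The bit \<open>x 0\<close> decides which of the two tilings covers the
  rest.\<close>

lemma rainbow_tiling_Cons:
  assumes "rainbow_tiling n d p D0" "rainbow_tiling n d p D1"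
  shows "rainbow_tiling (Suc n) (Suc d) (case_nat (Suc d) p) ((#) Zero ` D0 \<union> (#) One ` D1)"
  unfolding rainbow_tiling_def
proof (intro conjI ballI allI)
  fix w assume w: "w \<in> (#) Zero ` D0 \<union> (#) One ` D1"
  then obtain a u where u: "w = a # u" "a \<noteq> Star" "length u = n" "bij_betw p (fixed u) {1..d}"
    using assms by (auto simp: rainbow_tiling_def)
  then show "length w = Suc n" by simp
  have "bij_betw (case_nat (Suc d) p) (Suc ` fixed u) {1..d}"
    by (rule bij_betw_image_shift[OF u(4)]) auto
  moreover have "{1..Suc d} = insert (Suc d) {1..d}" by auto
  ultimately show "bij_betw (case_nat (Suc d) p) (fixed w) {1..Suc d}"
    using u(1,2) notIn_Un_bij_betw[of 0 "Suc ` fixed u" "case_nat (Suc d) p" "{1..d}"]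
    by (simp add: fixed_Cons)
next
  fix x :: "nat \<Rightarrow> bool"
  have "\<exists>!u. u \<in> (if x 0 then D1 else D0) \<and> agrees u (\<lambda>j. x (Suc j))"
    using assms by (simp add: rainbow_tiling_def)
  then obtain u where u: "u \<in> (if x 0 then D1 else D0)" "agrees u (\<lambda>j. x (Suc j))"
    and unique: "\<And>v. v \<in> (if x 0 then D1 else D0) \<Longrightarrow> agrees v (\<lambda>j. x (Suc j)) \<Longrightarrow> v = u"
    by metis
  show "\<exists>!w. w \<in> (#) Zero ` D0 \<union> (#) One ` D1 \<and> agrees w x"
  proof (rule ex1I[of _ "(if x 0 then One else Zero) # u"])
    show "(if x 0 then One else Zero) # u \<in> (#) Zero ` D0 \<union> (#) One ` D1 \<and>
        agrees ((if x 0 then One else Zero) # u) x"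
      using u by (simp add: agrees_Cons split: if_splits)
  next
    fix w assume w: "w \<in> (#) Zero ` D0 \<union> (#) One ` D1 \<and> agrees w x"
    then obtain a v where "w = a # v" "a = Zero \<and> v \<in> D0 \<or> a = One \<and> v \<in> D1" by blast
    with w unique[of v] show "w = (if x 0 then One else Zero) # u"
      by (auto simp: agrees_Cons split: if_splits)
  qed
qed

text \<open>Letters need only occur in the union, since after juxtaposition each padded tiling is
  \<open>Star\<close> on the coordinates of the other.\<close>

lemma all_letters_occur_Cons:
  assumes "all_letters_occur n (D0 \<union> D1)" "D0 \<noteq> {}" "D1 \<noteq> {}"
  shows "all_letters_occur (Suc n) ((#) Zero ` D0 \<union> (#) One ` D1)"
  unfolding all_letters_occur_def
proof (intro allI impI)
  fix j a assume j: "j < Suc n" and a: "a \<noteq> Star"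
  show "\<exists>w\<in>(#) Zero ` D0 \<union> (#) One ` D1. w ! j = a"
  proof (cases j)
    case 0
    then show ?thesis using a assms(2,3) by (cases a) (auto simp: bex_Un)
  next
    case (Suc i)
    then have "\<exists>u\<in>D0 \<union> D1. u ! i = a" using assms(1) j a by (auto simp: all_letters_occur_def)
    then show ?thesis using Suc by (auto simp: bex_Un)
  qed
qed

lemma all_letters_occur_juxtapose:
  assumes "all_letters_occur n D" "all_letters_occur m E" "\<And>u. u \<in> D \<Longrightarrow> length u = n"
  shows "all_letters_occur (n + m)
           ((\<lambda>u. u @ replicate m Star) ` D \<union> (\<lambda>u. replicate n Star @ u) ` E)"
  unfolding all_letters_occur_def
proof (intro allI impI)
  fix j a assume j: "j < n + m" and a: "a \<noteq> Star"
  show "\<exists>w\<in>(\<lambda>u. u @ replicate m Star) ` D \<union> (\<lambda>u. replicate n Star @ u) ` E. w ! j = a"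
  proof (cases "j < n")
    case True
    then obtain u where "u \<in> D" "u ! j = a" using assms(1) a by (auto simp: all_letters_occur_def)
    then show ?thesis
      using True assms(3) by (intro bexI[of _ "u @ replicate m Star"]) (auto simp: nth_append)
  next
    case False
    then have "j - n < m" using j by simp
    then obtain u where "u \<in> E" "u ! (j - n) = a"
      using assms(2) a unfolding all_letters_occur_def by blast
    then show ?thesis
      using False by (intro bexI[of _ "replicate n Star @ u"]) (auto simp: nth_append)
  qed
qed

lemma rainbow_tiling_nonempty: "rainbow_tiling n d p D \<Longrightarrow> D \<noteq> {}"
  by (auto simp: rainbow_tiling_def)

lemma rainbow_tiling_exists:
  assumes "d \<le> n" "n \<le> 2 ^ d - 1"
  shows "\<exists>p D. rainbow_tiling n d p D \<and> all_letters_occur n D"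
  using assms
proof (induction d arbitrary: n)
  case 0
  \<comment> \<open>The bounds force \<open>n = 0\<close>, and the empty word alone tiles the cube
    of dimension 0.\<close>
  then have "rainbow_tiling n 0 id {[]} \<and> all_letters_occur n {[]}"
    by (auto simp: rainbow_tiling_def all_letters_occur_def agrees_def fixed_def)
  then show ?case by blast
next
  case (Suc d)
  show ?case
  proof (cases "n \<le> 2 * d")
    case True
    \<comment> \<open>This puts \<open>n - 1\<close> within the range of the induction hypothesis,
      so one tiling can be used for both halves.\<close>
    have "2 * d \<le> 2 ^ d"
    proof (induction d)
      case (Suc e)
      then show ?case by (cases e) auto
    qed simp
    then have "d \<le> n - 1" "n - 1 \<le> 2 ^ d - 1" using Suc.prems(1) True by linarith+
    then obtain p D where D: "rainbow_tiling (n - 1) d p D" "all_letters_occur (n - 1) D"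
      using Suc.IH[of "n - 1"] by blast
    have "rainbow_tiling (Suc (n - 1)) (Suc d) (case_nat (Suc d) p) ((#) Zero ` D \<union> (#) One ` D)"
      using D(1) by (intro rainbow_tiling_Cons)
    moreover have "all_letters_occur (Suc (n - 1)) ((#) Zero ` D \<union> (#) One ` D)"
      using D rainbow_tiling_nonempty by (intro all_letters_occur_Cons) auto
    ultimately show ?thesis using Suc.prems(1) by auto
  next
    case False
    \<comment> \<open>Here \<open>2 * d \<le> n - 1 \<le> 2 * (2 ^ d - 1)\<close>, so halving
      \<open>n - 1\<close>, rounded down and up, leaves both parts between \<open>d\<close> and
      \<open>2 ^ d - 1\<close>.\<close>
    define k where "k = (n - 1) div 2"
    define m where "m = n - 1 - k"
    have n: "n = Suc (k + m)" using False by (simp add: k_def m_def)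
    have "d \<le> k" "d \<le> m" "k \<le> 2 ^ d - 1" "m \<le> 2 ^ d - 1"
      using False Suc.prems(2) by (auto simp: k_def m_def)
    then obtain p D q E where D: "rainbow_tiling k d p D" "all_letters_occur k D"
      and E: "rainbow_tiling m d q E" "all_letters_occur m E"
      using Suc.IH[of k] Suc.IH[of m] by blast
    let ?D = "(\<lambda>u. u @ replicate m Star) ` D" and ?E = "(\<lambda>u. replicate k Star @ u) ` E"
    \<comment> \<open>Block \<open>i\<close> of the first tiling is merged with the shifted block
      \<open>i\<close> of the second. Each padded word still fixes one position per block.\<close>
    let ?r = "\<lambda>j. if j < k then p j else q (j - k)"
    have "rainbow_tiling (k + m) d ?r ?D" "rainbow_tiling (k + m) d ?r ?E"
      using D(1) E(1) by (auto intro!: rainbow_tiling_append_Stars rainbow_tiling_Stars_append)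
    then have "rainbow_tiling n (Suc d) (case_nat (Suc d) ?r) ((#) Zero ` ?D \<union> (#) One ` ?E)"
      unfolding n by (rule rainbow_tiling_Cons)
    moreover have "all_letters_occur n ((#) Zero ` ?D \<union> (#) One ` ?E)"
      unfolding n using D E rainbow_tiling_nonempty
      by (intro all_letters_occur_Cons all_letters_occur_juxtapose) (auto simp: rainbow_tiling_def)
    ultimately show ?thesis by blast
  qed
qed

section \<open>From partition maps to regularity\<close>

lemma nths_conv_map_nth: "nths u N = map ((!) u) (filter (\<lambda>j. j \<in> N) [0..<length u])"
proof (induction u rule: rev_induct)
  case (snoc a u)
  have "map ((!) (u @ [a])) (filter (\<lambda>j. j \<in> N) [0..<length u]) =
      map ((!) u) (filter (\<lambda>j. j \<in> N) [0..<length u])"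
    by (auto simp: nth_append)
  with snoc show ?case by (simp add: nths_append)
qed simp

text \<open>Bijectivity of \<open>p\<close> on the fixed positions gives each word exactly one fixed
  position in block \<open>N\<close>. Conversely, a word having the wanted letter at the wanted
  position must be \<open>Star\<close> on the rest of the block.\<close>

lemma regular_restrictions:
  assumes D: "\<And>u. u \<in> D \<Longrightarrow> length u = n \<and> bij_betw p (fixed u) {1..d}"
    and occ: "all_letters_occur n D" and i: "i \<in> {1..d}"
    and N: "N = {j. j < n \<and> p j = i}"
  shows "(\<lambda>u. nths u N) ` D = {w. length w = card N \<and> (\<exists>!j. j < length w \<and> w ! j \<noteq> Star)}"
proof -
  \<comment> \<open>The positions of the block in increasing order, translating indices of
    restricted words into coordinates.\<close>
  define ks where "ks = filter (\<lambda>j. j \<in> N) [0..<n]"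
  have ks: "distinct ks" "set ks = N" by (auto simp: ks_def N)
  then have len_ks: "length ks = card N" using distinct_card by fastforce
  have restrict: "nths u N = map ((!) u) ks" if "u \<in> D" for u
    using D[OF that] by (simp add: nths_conv_map_nth ks_def)
  have unique: "\<exists>!k. k \<in> N \<and> u ! k \<noteq> Star" if "u \<in> D" for u
  proof -
    have u: "length u = n" "inj_on p (fixed u)" "p ` fixed u = {1..d}"
      using D[OF that] by (auto simp: bij_betw_def)
    from u(3) i obtain k where "k \<in> fixed u" "p k = i" by (metis imageE)
    with u(1,2) show ?thesis
      by (intro ex1I[of _ k]) (auto simp: N fixed_def inj_on_def)
  qed
  have unique_ks: "\<exists>!j. j < length ks \<and> u ! (ks ! j) \<noteq> Star" if u: "u \<in> D" for u
  proof -
    obtain k where k: "k \<in> N" "u ! k \<noteq> Star" "\<And>l. l \<in> N \<Longrightarrow> u ! l \<noteq> Star \<Longrightarrow> l = k"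
      using unique[OF u] by metis
    then obtain j where j: "j < length ks" "ks ! j = k" using ks(2) by (metis in_set_conv_nth)
    show ?thesis
    proof (rule ex1I[of _ j])
      fix l assume "l < length ks \<and> u ! (ks ! l) \<noteq> Star"
      then have "l < length ks" "ks ! l = k" using k(3) ks(2) by auto
      with j ks(1) show "l = j" by (metis nth_eq_iff_index_eq)
    qed (use j k(2) in simp)
  qed
  show ?thesis
  proof (intro equalityI subsetI)
    fix w assume "w \<in> (\<lambda>u. nths u N) ` D"
    then obtain u where u: "u \<in> D" "w = map ((!) u) ks" by (elim imageE) (simp add: restrict)
    then have "j < length w \<and> w ! j \<noteq> Star \<longleftrightarrow> j < length ks \<and> u ! (ks ! j) \<noteq> Star" for j
      by (metis length_map nth_map)
    then have "\<exists>!j. j < length w \<and> w ! j \<noteq> Star" using unique_ks[OF u(1)] by presburger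
    then show "w \<in> {w. length w = card N \<and> (\<exists>!j. j < length w \<and> w ! j \<noteq> Star)}"
      using u(2) len_ks by simp
  next
    fix w assume "w \<in> {w. length w = card N \<and> (\<exists>!j. j < length w \<and> w ! j \<noteq> Star)}"
    then have w: "length w = length ks" and "\<exists>!j. j < length w \<and> w ! j \<noteq> Star"
      unfolding len_ks by blast+
    from this(2) obtain j where j: "j < length ks" "w ! j \<noteq> Star"
      and w_Star: "\<And>l. l < length ks \<Longrightarrow> l \<noteq> j \<Longrightarrow> w ! l = Star"
      unfolding w by blast
    have "ks ! j < n" using j(1) ks(2) nth_mem N by blast
    with occ j(2) obtain u where u: "u \<in> D" "u ! (ks ! j) = w ! j"
      unfolding all_letters_occur_def by metis
    have "w = map ((!) u) ks"
    proof (rule nth_equalityI)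
      fix l assume "l < length w"
      then have l: "l < length ks" by (simp add: w)
      have "u ! (ks ! j) \<noteq> Star" using u(2) j(2) by simp
      then have "u ! (ks ! l) = Star" if "l \<noteq> j" using unique_ks[OF u(1)] j(1) l that by blast
      then show "w ! l = map ((!) u) ks ! l"
        using w_Star[of l] u(2) l by (cases "l = j") auto
    qed (simp add: w)
    then show "w \<in> (\<lambda>u. nths u N) ` D"
      using u(1) by (intro image_eqI[of _ _ u]) (simp_all add: restrict)
  qed
qed

lemma regular_tilingI:
  assumes "rainbow_tiling n d p D" "all_letters_occur n D"
  shows "domino_tiling n d D" "regular_tiling n d D" "star_irreducible n D"
proof -
  have D: "length u = n \<and> bij_betw p (fixed u) {1..d}" if "u \<in> D" for u
    using assms(1) that by (simp add: rainbow_tiling_def)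
  then have "card (fixed u) = d" if "u \<in> D" for u
    using that bij_betw_same_card by fastforce
  then show "domino_tiling n d D"
    using assms(1) by (simp add: domino_tiling_iff rainbow_tiling_def)
  have occurs: "\<exists>u\<in>D. u ! j \<noteq> Star" if "j < n" for j
    using assms(2) that unfolding all_letters_occur_def by (metis letter.distinct(3))
  then show "star_irreducible n D" unfolding star_irreducible_def by blast
  define N where "N i = {j. j < n \<and> p j = i}" for i
  \<comment> \<open>The values of \<open>p\<close> are controlled only at fixed positions; each
    coordinate is one in some word. Hence the blocks cover \<open>{..<n}\<close> and the exceptional
    set can be empty.\<close>
  have "p j \<in> {1..d}" if "j < n" for j
  proof -
    obtain u where u: "u \<in> D" "u ! j \<noteq> Star" using occurs \<open>j < n\<close> by blast
    then have "j \<in> fixed u" using D[of u] \<open>j < n\<close> by (simp add: fixed_def)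
    then show ?thesis using D[OF u(1)] bij_betwE by blast
  qed
  then have "(\<Union>i\<in>{1..d}. N i) = {..<n}" by (auto simp: N_def)
  moreover have "N i \<noteq> {}" if "i \<in> {1..d}" for i
  proof -
    obtain u where "u \<in> D" using rainbow_tiling_nonempty[OF assms(1)] by blast
    then have "i \<in> p ` fixed u" "length u = n" using D that by (auto simp: bij_betw_def)
    then show ?thesis by (auto simp: N_def fixed_def)
  qed
  moreover have "disjoint_family_on N {1..d}" by (auto simp: disjoint_family_on_def N_def)
  ultimately show "regular_tiling n d D"
    unfolding regular_tiling_def
    using regular_restrictions[OF D assms(2) _ N_def]
    by (intro exI[of _ N] exI[of _ "{}"]) simp
qed

theorem theorem2:
  fixes n d :: nat
  assumes "d \<ge> 1" and "n > d"
  shows "(\<exists>D. domino_tiling n d D \<and> regular_tiling n d D \<and> star_irreducible n D) \<longleftrightarrow>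
         n \<in> {d + 1..2 ^ d - 1}"
proof
  assume "\<exists>D. domino_tiling n d D \<and> regular_tiling n d D \<and> star_irreducible n D"
  then show "n \<in> {d + 1..2 ^ d - 1}"
    using star_irreducible_dimension_bound[of n d] assms(2) by fastforce
next
  assume "n \<in> {d + 1..2 ^ d - 1}"
  then show "\<exists>D. domino_tiling n d D \<and> regular_tiling n d D \<and> star_irreducible n D"
    using rainbow_tiling_exists[of d n] regular_tilingI by (metis add_leE atLeastAtMost_iff)
qed

end
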